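(* Let $b_{ij}\in F$ ($1\le i<j\le 6$) be generic, put $\omega_{ijk}=b_{ij}-b_{ik}+b_{jk}$ for $i<j<k$, and let permitted colorings of the simplices of the 5-simplex $\Delta^5=123456$ be defined by the "infinitesimal" edge functionals built from $\omega$. Then there exists a nontrivial symmetric bilinear 4-cocycle on $\Delta^5$; that is, a symmetric bilinear 4-cochain $\mathfrak c$ with $\delta\mathfrak c=0$ that is not the coboundary of any symmetric bilinear 3-cochain.
   Context: A pentachoron is a 4-simplex and a tetrahedron is a 3-simplex; simplices are written with vertices in increasing order. $F$ is a field (any characteristic), big enough to contain generic elements; "generic" means that the $b_{ij}$ lie outside the zero set of some suitable nonzero polynomial (they satisfy no accidental algebraic relation). A coloring assigns to each tetrahedron $t$ a column $(x_t,y_t)^{\mathrm T}\in F^2$. Orient each pentachoron $u$ by the increasing order of its vertices. For a tetrahedron $t\subset u$, $\epsilon_t^{(u)}=+1$ if the orientation of $t$ given by the increasing order of its vertices coincides with that induced from $u$, and $-1$ otherwise (so that, up to an overall sign per pentachoron, $\epsilon_t^{(u)}=(-1)^m$ if $t$ is obtained from $u=i_0\dots i_4$ by omitting $i_m$). Infinitesimal edge functionals: for a tetrahedron $t=1234$ set $$r(12)=(\omega_{234}-\omega_{134},\,0),\quad r(13)=(\omega_{124},\,\omega_{234}),\quad r(14)=(-\omega_{123},\,-\omega_{234}),$$ $$r(23)=(-\omega_{124},\,-\omega_{134}),\quad r(24)=(\omega_{123},\,\omega_{134}),\quad r(34)=(0,\,\omega_{123}-\omega_{124}),$$ and for $t=ijkl$,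 $i<j<k<l$, define the rows $r_t(e)$ ($e$ an edge of $t$) by substituting $1\mapsto i$, $2\mapsto j$, $3\mapsto k$, $4\mapsto l$. For an edge $e\subset u$, the edge functional is $\phi^{(u)}_{e}=\sum_{t:\ e\subset t\subset u}\epsilon^{(u)}_t\,r_t(e)\,(x_t,y_t)^{\mathrm T}$. A coloring of a pentachoron $u$ is permitted if $\phi_e^{(u)}=0$ for all ten edges $e\subset u$. All colorings of a tetrahedron are permitted; a coloring of $\Delta^5$ is permitted if its restrictions to all six pentachora are permitted. Cohomology: for $n\ge3$, a symmetric bilinear $n$-cochain $\mathfrak c$ assigns to each $n$-simplex $i_0\dots i_n$ of $\Delta^5$ a symmetric bilinear form $\mathfrak c_{i_0\dots i_n}$ with values in $F$ on the vector space of permitted colorings of that simplex. The coboundary is $(\delta\mathfrak c)_{i_0\dots i_{n+1}}=\sum_{m=0}^{n+1}(-1)^m\mathfrak c_{i_0\dots\widehat{i_m}\dots i_{n+1}}$, where each term is evaluated on the restrictions of the permitted colorings to the corresponding face. *)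

theory Defs
  imports
    "HOL-Library.Poly_Mapping"
    "HOL-Library.Function_Algebras"
    "HOL-Library.Product_Plus"
begin

text \<open>
  Simplices of \<open>\<Delta>\<^sup>5 = 123456\<close> are strictly increasing vertex lists, and edges are pairs
  \<open>(i, j)\<close> with \<open>i < j\<close>.
\<close>

definition simplices :: "nat \<Rightarrow> nat list set" where
  "simplices n = {s. sorted_wrt (<) s \<and> set s \<subseteq> {1..6} \<and> length s = Suc n}"

definition edges :: "nat list \<Rightarrow> (nat \<times> nat) set" where
  "edges s = {(i, j). i \<in> set s \<and> j \<in> set s \<and> i < j}"

abbreviation whole_simplex :: "nat list" where
  "whole_simplex \<equiv> [1, 2, 3, 4, 5, 6]"

definition omit :: "nat \<Rightarrow> nat list \<Rightarrow> nat list" where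
  "omit m s = take m s @ drop (Suc m) s"

text \<open>
  A coloring of a simplex \<open>s\<close> assigns a vector of \<open>F\<^sup>2\<close> to each tetrahedron of \<open>s\<close>.  It is
  represented by a total function that is zero on every list that is not a tetrahedron of \<open>s\<close>,
  so that colorings are added and compared as functions.
\<close>

type_synonym 'a coloring = "nat list \<Rightarrow> 'a \<times> 'a"

definition tetrahedra :: "nat list \<Rightarrow> nat list set" where
  "tetrahedra s = {t \<in> simplices 3. set t \<subseteq> set s}"

definition colorings :: "nat list \<Rightarrow> ('a :: field) coloring set" where
  "colorings s = {x. \<forall>t. t \<notin> tetrahedra s \<longrightarrow> x t = 0}"

definition scale :: "'a :: field \<Rightarrow> 'a coloring \<Rightarrow> 'a coloring" where
  "scale c x = (\<lambda>t. (c * fst (x t), c * snd (x t)))"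

definition restriction :: "nat list \<Rightarrow> ('a :: field) coloring \<Rightarrow> 'a coloring" where
  "restriction s x = (\<lambda>t. if t \<in> tetrahedra s then x t else 0)"

definition omega :: "(nat \<times> nat \<Rightarrow> 'a :: field) \<Rightarrow> nat \<Rightarrow> nat \<Rightarrow> nat \<Rightarrow> 'a" where
  "omega b i j k = b (i, j) - b (i, k) + b (j, k)"

fun edge_row :: "(nat \<times> nat \<Rightarrow> 'a :: field) \<Rightarrow> nat list \<Rightarrow> nat \<times> nat \<Rightarrow> 'a \<times> 'a" where
  "edge_row b [i, j, k, l] e =
    (if e = (i, j) then (omega b j k l - omega b i k l, 0)
     else if e = (i, k) then (omega b i j l, omega b j k l)
     else if e = (i, l) then (- omega b i j k, - omega b j k l)
     else if e = (j, k) then (- omega b i j l, - omega b i k l)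
     else if e = (j, l) then (omega b i j k, omega b i k l)
     else if e = (k, l) then (0, omega b i j k - omega b i j l)
     else 0)"
| "edge_row b _ e = 0"

text \<open>
  If \<open>u\<close> carries the orientation of its increasing vertex order, the face omitting the
  \<open>m\<close>-th vertex (counted from 0) has incidence sign \<open>(-1)\<^sup>m\<close>.
\<close>

definition edge_functional ::
  "(nat \<times> nat \<Rightarrow> 'a :: field) \<Rightarrow> nat list \<Rightarrow> nat \<times> nat \<Rightarrow> 'a coloring \<Rightarrow> 'a" where
  "edge_functional b u e x =
    (\<Sum>m | m < length u \<and> e \<in> edges (omit m u).
      (-1) ^ m * (fst (edge_row b (omit m u) e) * fst (x (omit m u)) +
                  snd (edge_row b (omit m u) e) * snd (x (omit m u))))"

definition permitted :: "(nat \<times> nat \<Rightarrow> 'a :: field) \<Rightarrow> nat list \<Rightarrow> 'a coloring set" where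
  "permitted b s = {x \<in> colorings s.
    \<forall>u \<in> simplices 4. set u \<subseteq> set s \<longrightarrow> (\<forall>e \<in> edges u. edge_functional b u e x = 0)}"

definition symmetric_bilinear_on ::
  "('a :: field) coloring set \<Rightarrow> ('a coloring \<Rightarrow> 'a coloring \<Rightarrow> 'a) \<Rightarrow> bool" where
  "symmetric_bilinear_on V B \<longleftrightarrow>
    (\<forall>x \<in> V. \<forall>y \<in> V. B x y = B y x) \<and>
    (\<forall>x \<in> V. \<forall>x' \<in> V. \<forall>y \<in> V. B (x + x') y = B x y + B x' y) \<and>
    (\<forall>a. \<forall>x \<in> V. \<forall>y \<in> V. B (scale a x) y = a * B x y)"

text \<open>
  Only the values of \<open>c s\<close> on permitted colorings of \<open>s\<close> are meaningful; accordingly, equality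
  of cochains is always equality on permitted colorings.
\<close>

type_synonym 'a cochain = "nat list \<Rightarrow> 'a coloring \<Rightarrow> 'a coloring \<Rightarrow> 'a"

definition symmetric_bilinear_cochain ::
  "(nat \<times> nat \<Rightarrow> 'a :: field) \<Rightarrow> nat \<Rightarrow> 'a cochain \<Rightarrow> bool" where
  "symmetric_bilinear_cochain b n c \<longleftrightarrow>
    (\<forall>s \<in> simplices n. symmetric_bilinear_on (permitted b s) (c s))"

definition coboundary :: "('a :: field) cochain \<Rightarrow> 'a cochain" where
  "coboundary c s x y =
    (\<Sum>m < length s. (-1) ^ m * c (omit m s) (restriction (omit m s) x) (restriction (omit m s) y))"

definition cochain_eq ::
  "(nat \<times> nat \<Rightarrow> 'a :: field) \<Rightarrow> nat \<Rightarrow> 'a cochain \<Rightarrow> 'a cochain \<Rightarrow> bool" where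
  "cochain_eq b n c d \<longleftrightarrow>
    (\<forall>s \<in> simplices n. \<forall>x \<in> permitted b s. \<forall>y \<in> permitted b s. c s x y = d s x y)"

definition nontrivial_symmetric_bilinear_4_cocycle ::
  "(nat \<times> nat \<Rightarrow> 'a :: field) \<Rightarrow> 'a cochain \<Rightarrow> bool" where
  "nontrivial_symmetric_bilinear_4_cocycle b c \<longleftrightarrow>
    symmetric_bilinear_cochain b 4 c \<and>
    cochain_eq b 5 (coboundary c) (\<lambda>s x y. 0) \<and>
    \<not> (\<exists>d. symmetric_bilinear_cochain b 3 d \<and> cochain_eq b 4 c (coboundary d))"

text \<open>
  Polynomials over \<open>'a\<close> whose variables are indexed by pairs: \<open>lookup P m\<close> is the coefficient
  of the monomial with exponents \<open>lookup m\<close>.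
\<close>

type_synonym 'a edge_poly = "((nat \<times> nat) \<Rightarrow>\<^sub>0 nat) \<Rightarrow>\<^sub>0 'a"

definition eval_poly :: "(nat \<times> nat \<Rightarrow> 'a :: field) \<Rightarrow> 'a edge_poly \<Rightarrow> 'a" where
  "eval_poly b P =
    (\<Sum>m \<in> Poly_Mapping.keys P. Poly_Mapping.lookup P m *
      (\<Prod>v \<in> Poly_Mapping.keys m. b v ^ Poly_Mapping.lookup m v))"

text \<open>
  A genericity condition is a nonzero polynomial in the variables \<open>b\<^sub>i\<^sub>j\<close> (\<open>1 \<le> i < j \<le> 6\<close>).
  Its coefficients lie in \<open>\<int>\<close>, here the image of the integers in \<open>'a\<close>, so they do not depend
  on the elements of the field: it is also satisfied by any \<open>b\<^sub>i\<^sub>j\<close> that are algebraically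
  independent over the prime field.
\<close>

definition genericity_condition :: "('a :: field) edge_poly \<Rightarrow> bool" where
  "genericity_condition P \<longleftrightarrow>
    P \<noteq> 0 \<and>
    (\<forall>m. Poly_Mapping.lookup P m \<in> \<int>) \<and>
    (\<forall>m \<in> Poly_Mapping.keys P. Poly_Mapping.keys m \<subseteq> edges whole_simplex)"

end

theory Submission
  imports Defs "HOL-Library.Product_Lexorder"
begin

text \<open>
  An arbitrary edge function \<open>a\<close> is read as an infinitesimal change of \<open>b\<close>.  With
  \<open>h\<^sub>i\<^sub>j\<^sub>k = \<omega>\<^sub>i\<^sub>j\<^sub>k(a) / \<omega>\<^sub>i\<^sub>j\<^sub>k(b)\<close> and \<open>D = \<omega>\<^sub>i\<^sub>j\<^sub>k(b) - \<omega>\<^sub>i\<^sub>j\<^sub>l(b)\<close>, color the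
  tetrahedron \<open>ijkl\<close> by \<open>((h\<^sub>i\<^sub>j\<^sub>l - h\<^sub>i\<^sub>j\<^sub>k) / D, (h\<^sub>j\<^sub>k\<^sub>l - h\<^sub>i\<^sub>k\<^sub>l) / D)\<close>.  In these terms the row
  \<open>r\<^sub>t(e)\<close> yields the coefficient at \<open>e\<close> of the 1-chain \<open>\<Sum>\<^sub>f \<plusminus> h\<^sub>f \<partial>f\<close> over the faces \<open>f\<close> of \<open>t\<close>
  (\<open>row_value_variation_coloring\<close>), so in a pentachoron every triangle contributes twice with
  opposite signs and the coloring is permitted.  Conversely every permitted coloring of a
  pentachoron or of \<open>\<Delta>\<^sup>5\<close> arises in this way (\<open>pentachoron_lift\<close>, \<open>whole_lift\<close>), and it
  determines the simplicial 2-cocycle \<open>\<eta> = \<omega>(a)\<close> up to multiples of \<open>\<omega>(b)\<close>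
  (\<open>same_coloring_ratio\<close>).  A symmetric bilinear form on permitted colorings is therefore a
  symmetric bilinear form in \<open>\<eta>\<close> that has \<open>\<omega>(b)\<close> in its radical.

  The symmetrized cup product \<open>\<eta> \<smile> \<eta>' + \<eta>' \<smile> \<eta>\<close> is a 4-cocycle of forms in \<open>\<eta>\<close>, but its
  radical does not contain \<open>\<omega>(b)\<close>.  Since \<open>\<omega>(b)\<close> is the coboundary of \<open>b\<close>, inserting it gives
  the coboundary of \<open>b\<^sub>1\<^sub>2 \<eta>\<^sub>2\<^sub>3\<^sub>4 + \<eta>\<^sub>1\<^sub>2\<^sub>3 b\<^sub>3\<^sub>4\<close>, and this linear form is what
  \<open>b\<^sub>1\<^sub>2 \<eta>\<^sub>2\<^sub>3\<^sub>4 \<eta>'\<^sub>2\<^sub>3\<^sub>4 / \<omega>\<^sub>2\<^sub>3\<^sub>4 + b\<^sub>3\<^sub>4 \<eta>\<^sub>1\<^sub>2\<^sub>3 \<eta>'\<^sub>1\<^sub>2\<^sub>3 / \<omega>\<^sub>1\<^sub>2\<^sub>3\<close> becomes at \<open>\<eta>' = \<omega>(b)\<close>.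
  Subtracting the coboundary of the latter repairs the radical and preserves closedness
  (\<open>cocycle_form_radical\<close>, \<open>cocycle_closed\<close>).

  For nontriviality let \<open>e\<^sub>p\<^sub>q\<close> be the coloring that belongs to the indicator function of the edge
  \<open>pq\<close>, and evaluate a form \<open>c\<close> on \<open>12345\<close> by
  \<open>c(e\<^sub>2\<^sub>3, e\<^sub>4\<^sub>5) - c(e\<^sub>2\<^sub>4, e\<^sub>3\<^sub>5) + c(e\<^sub>2\<^sub>5, e\<^sub>3\<^sub>4)\<close>.  A form pulled back from a tetrahedron through
  the vertex 1 gives 0, because the tetrahedron misses an edge of each pair; one pulled back from
  \<open>2345\<close> gives 0 by the Pluecker relation.  Hence coboundaries give 0, whereas the cocycle
  gives 1 in every characteristic (\<open>cocycle_not_coboundary\<close>).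

  The genericity used is that all \<open>\<omega>\<^sub>i\<^sub>j\<^sub>k(b)\<close> and all \<open>D\<close> are nonzero, that is, that the product
  of these linear polynomials does not vanish at \<open>b\<close>.
\<close>

section \<open>Polynomials in the edge variables\<close>

definition edge_var :: "nat \<times> nat \<Rightarrow> ('a :: field) edge_poly" where
  "edge_var e = Poly_Mapping.single (Poly_Mapping.single e 1) 1"

definition monomial_value :: "(nat \<times> nat \<Rightarrow> 'a :: field) \<Rightarrow> (nat \<times> nat \<Rightarrow>\<^sub>0 nat) \<Rightarrow> 'a" where
  "monomial_value b m = (\<Prod>v \<in> Poly_Mapping.keys m. b v ^ Poly_Mapping.lookup m v)"

lemma monomial_value_superset:
  assumes "finite V" "Poly_Mapping.keys m \<subseteq> V"
  shows "monomial_value b m = (\<Prod>v \<in> V. b v ^ Poly_Mapping.lookup m v)"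
  unfolding monomial_value_def
  by (rule prod.mono_neutral_left) (use assms in \<open>auto simp: in_keys_iff\<close>)

lemma monomial_value_add: "monomial_value b (m + n) = monomial_value b m * monomial_value b n"
proof -
  let ?V = "Poly_Mapping.keys m \<union> Poly_Mapping.keys n"
  have "Poly_Mapping.keys (m + n) \<subseteq> ?V" by (rule keys_add)
  then show ?thesis
    by (subst (1 2 3) monomial_value_superset[where V = ?V])
      (auto simp: lookup_add power_add prod.distrib)
qed

lemma eval_poly_superset:
  assumes "finite M" "Poly_Mapping.keys P \<subseteq> M"
  shows "eval_poly b P = (\<Sum>m \<in> M. Poly_Mapping.lookup P m * monomial_value b m)"
  unfolding eval_poly_def monomial_value_def[symmetric]
  by (rule sum.mono_neutral_left) (use assms in \<open>auto simp: in_keys_iff\<close>)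

lemma eval_poly_add: "eval_poly b (P + Q) = eval_poly b P + eval_poly b Q"
proof -
  let ?M = "Poly_Mapping.keys P \<union> Poly_Mapping.keys Q"
  have "Poly_Mapping.keys (P + Q) \<subseteq> ?M" by (rule keys_add)
  then show ?thesis
    by (subst (1 2 3) eval_poly_superset[where M = ?M])
      (auto simp: lookup_add sum.distrib algebra_simps)
qed

lemma eval_poly_single: "eval_poly b (Poly_Mapping.single m c) = c * monomial_value b m"
  by (subst eval_poly_superset[where M = "{m}"]) auto

lemma eval_poly_sum: "eval_poly b (sum P I) = (\<Sum>i \<in> I. eval_poly b (P i))"
  by (induction I rule: infinite_finite_induct) (auto simp: eval_poly_add eval_poly_def[of b 0])

lemma poly_expansion: "P = (\<Sum>m \<in> Poly_Mapping.keys P. Poly_Mapping.single m (Poly_Mapping.lookup P m))"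
  by (rule poly_mapping_eqI)
    (auto simp: lookup_sum lookup_single when_def in_keys_iff sum.delta' if_distrib cong: if_cong)

text \<open>
  Reduces multiplicativity of evaluation, and closure of the integral polynomials under products, to
  single monomials.
\<close>

lemma poly_times_expansion:
  "P * Q = (\<Sum>m \<in> Poly_Mapping.keys P. \<Sum>n \<in> Poly_Mapping.keys Q.
     Poly_Mapping.single (m + n) (Poly_Mapping.lookup P m * Poly_Mapping.lookup Q n))"
  by (subst poly_expansion[of P], subst poly_expansion[of Q])
    (simp add: sum_product mult_single)

lemma eval_poly_times: "eval_poly b (P * Q) = eval_poly b P * eval_poly b Q"
  by (subst poly_times_expansion)
    (simp add: eval_poly_sum eval_poly_single monomial_value_add eval_poly_def[of b P]
      eval_poly_def[of b Q] monomial_value_def[symmetric] sum_product mult.assoc mult.left_commute)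

definition integral_edge_polys :: "('a :: field) edge_poly set" where
  "integral_edge_polys = {P. (\<forall>m. Poly_Mapping.lookup P m \<in> \<int>) \<and>
    (\<forall>m \<in> Poly_Mapping.keys P. Poly_Mapping.keys m \<subseteq> edges whole_simplex)}"

lemma integral_edge_polys_add:
  "P \<in> integral_edge_polys \<Longrightarrow> Q \<in> integral_edge_polys \<Longrightarrow> P + Q \<in> integral_edge_polys"
  using keys_add[of P Q] by (fastforce simp: integral_edge_polys_def lookup_add)

lemma integral_edge_polys_diff:
  "P \<in> integral_edge_polys \<Longrightarrow> Q \<in> integral_edge_polys \<Longrightarrow> P - Q \<in> integral_edge_polys"
  using keys_diff[of P Q] by (fastforce simp: integral_edge_polys_def lookup_minus)

lemma integral_edge_polys_sum:
  "(\<And>i. i \<in> I \<Longrightarrow> P i \<in> integral_edge_polys) \<Longrightarrow> sum P I \<in> integral_edge_polys"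
  by (induction I rule: infinite_finite_induct)
    (auto simp: integral_edge_polys_add, auto simp: integral_edge_polys_def)

lemma integral_edge_polys_single:
  "c \<in> \<int> \<Longrightarrow> Poly_Mapping.keys m \<subseteq> edges whole_simplex \<Longrightarrow> Poly_Mapping.single m c \<in> integral_edge_polys"
  by (auto simp: integral_edge_polys_def lookup_single when_def split: if_splits)

lemma integral_edge_polys_times:
  "P \<in> integral_edge_polys \<Longrightarrow> Q \<in> integral_edge_polys \<Longrightarrow> P * Q \<in> integral_edge_polys"
  by (subst poly_times_expansion, intro integral_edge_polys_sum integral_edge_polys_single)
    (use keys_add in \<open>fastforce simp: integral_edge_polys_def\<close>)+

lemma integral_edge_polys_prod:
  "(\<And>i. i \<in> I \<Longrightarrow> P i \<in> integral_edge_polys) \<Longrightarrow> prod P I \<in> integral_edge_polys"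
  by (induction I rule: infinite_finite_induct)
    (auto simp: integral_edge_polys_times single_one[symmetric] intro!: integral_edge_polys_single
      simp del: single_one)

lemma integral_edge_polys_edge_var: "e \<in> edges whole_simplex \<Longrightarrow> edge_var e \<in> integral_edge_polys"
  unfolding edge_var_def by (rule integral_edge_polys_single) auto

lemma eval_poly_edge_var: "eval_poly b (edge_var e) = b e"
  by (simp add: edge_var_def eval_poly_single monomial_value_def)

lemma eval_poly_diff: "eval_poly b (P - Q) = eval_poly b P - eval_poly b Q"
  using eval_poly_add[of b "P - Q" Q] by simp

lemma eval_poly_prod_factor:
  "finite I \<Longrightarrow> i \<in> I \<Longrightarrow> eval_poly b (prod P I) \<noteq> 0 \<Longrightarrow> eval_poly b (P i) \<noteq> 0"
  by (simp add: prod.remove eval_poly_times)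

section \<open>The genericity polynomial\<close>

definition omega_poly :: "nat \<Rightarrow> nat \<Rightarrow> nat \<Rightarrow> ('a :: field) edge_poly" where
  "omega_poly i j k = edge_var (i, j) - edge_var (i, k) + edge_var (j, k)"

definition generic_poly :: "('a :: field) edge_poly" where
  "generic_poly =
    (\<Prod>(i, j, k) \<in> {(i, j, k). 1 \<le> i \<and> i < j \<and> j < k \<and> k \<le> 6}. omega_poly i j k) *
    (\<Prod>(i, j, k, l) \<in> {(i, j, k, l). 1 \<le> i \<and> i < j \<and> j < k \<and> k < l \<and> l \<le> 6}.
      omega_poly i j k - omega_poly i j l)"

lemma single_one_eq_iff:
  "Poly_Mapping.single e (1 :: nat) = Poly_Mapping.single e' 1 \<longleftrightarrow> e = e'"
  by (metis lookup_single_eq lookup_single_not_eq zero_neq_one)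

lemma omega_poly_nonzero:
  assumes "i < j" "j < k"
  shows "omega_poly i j k \<noteq> (0 :: ('a :: field) edge_poly)"
proof -
  have "Poly_Mapping.lookup (omega_poly i j k :: 'a edge_poly) (Poly_Mapping.single (i, j) 1) = 1"
    using assms by (simp add: omega_poly_def edge_var_def lookup_add lookup_minus lookup_single
      single_one_eq_iff[unfolded One_nat_def])
  then show ?thesis by auto
qed

lemma omega_poly_diff_nonzero:
  assumes "i < j" "j < k" "k < l"
  shows "omega_poly i j k \<noteq> (omega_poly i j l :: ('a :: field) edge_poly)"
proof -
  have "Poly_Mapping.lookup (omega_poly i j k - omega_poly i j l :: 'a edge_poly)
      (Poly_Mapping.single (j, k) 1) = 1"
    using assms by (simp add: omega_poly_def edge_var_def lookup_add lookup_minus lookup_single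
      single_one_eq_iff[unfolded One_nat_def])
  then show ?thesis by auto
qed

lemma finite_tuples:
  "finite {(i, j, k). 1 \<le> i \<and> i < j \<and> j < k \<and> k \<le> (6::nat)}"
  "finite {(i, j, k, l). 1 \<le> i \<and> i < j \<and> j < k \<and> k < l \<and> l \<le> (6::nat)}"
  by (rule finite_subset[of _ "{..6} \<times> {..6} \<times> {..6}"]; force)
    (rule finite_subset[of _ "{..6} \<times> {..6} \<times> {..6} \<times> {..6}"]; force)

text \<open>
  The polynomial ring over a linearly ordered set of variables has no zero divisors, so it suffices that
  each linear factor is nonzero; a coefficient 1 witnesses this in every characteristic.
\<close>

lemma genericity_condition_generic_poly: "genericity_condition generic_poly"
proof -
  have "generic_poly \<noteq> (0 :: 'a edge_poly)"
    using finite_tuples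
    by (auto simp: generic_poly_def omega_poly_nonzero omega_poly_diff_nonzero)
  moreover have "generic_poly \<in> integral_edge_polys"
    unfolding generic_poly_def omega_poly_def
    by (auto intro!: integral_edge_polys_times integral_edge_polys_prod integral_edge_polys_diff
       integral_edge_polys_add integral_edge_polys_edge_var simp: edges_def)
  ultimately show ?thesis
    by (simp add: genericity_condition_def integral_edge_polys_def)
qed

lemma generic_polyD:
  assumes "eval_poly b generic_poly \<noteq> 0"
  shows "1 \<le> i \<Longrightarrow> i < j \<Longrightarrow> j < k \<Longrightarrow> k \<le> 6 \<Longrightarrow> omega b i j k \<noteq> 0"
    and "1 \<le> i \<Longrightarrow> i < j \<Longrightarrow> j < k \<Longrightarrow> k < l \<Longrightarrow> l \<le> 6 \<Longrightarrow> omega b i j k \<noteq> omega b i j l"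
proof -
  have eval: "eval_poly b (omega_poly i j k) = omega b i j k" for i j k
    by (simp add: omega_poly_def omega_def eval_poly_add eval_poly_diff eval_poly_edge_var)
  note factors = assms[unfolded generic_poly_def eval_poly_times mult_eq_0_iff de_Morgan_disj]
  show "omega b i j k \<noteq> 0" if "1 \<le> i" "i < j" "j < k" "k \<le> 6"
    using eval_poly_prod_factor[OF finite_tuples(1) _ conjunct1[OF factors], of "(i, j, k)"] that
    by (simp add: eval)
  show "omega b i j k \<noteq> omega b i j l" if "1 \<le> i" "i < j" "j < k" "k < l" "l \<le> 6"
    using eval_poly_prod_factor[OF finite_tuples(2) _ conjunct2[OF factors], of "(i, j, k, l)"] that
    by (simp add: eval eval_poly_diff)
qed

section \<open>Simplices and edge functionals\<close>

lemma pentachoron_cases: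
  assumes "u \<in> simplices 4"
  obtains i j k l m where "u = [i, j, k, l, m]" "1 \<le> i" "i < j" "j < k" "k < l" "l < m" "m \<le> 6"
proof -
  have "length u = Suc (Suc (Suc (Suc (Suc 0))))"
    using assms by (simp add: simplices_def)
  then obtain i j k l m where "u = [i, j, k, l, m]"
    by (auto simp: length_Suc_conv)
  then show thesis
    using that[of i j k l m] assms by (simp add: simplices_def)
qed

lemma tetrahedron_cases:
  assumes "t \<in> simplices 3"
  obtains i j k l where "t = [i, j, k, l]" "1 \<le> i" "i < j" "j < k" "k < l" "l \<le> 6"
proof -
  have "length t = Suc (Suc (Suc (Suc 0)))"
    using assms by (simp add: simplices_def)
  then obtain i j k l where "t = [i, j, k, l]"
    by (auto simp: length_Suc_conv)
  then show thesis
    using that[of i j k l] assms by (simp add: simplices_def)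
qed

lemma strict_sorted_eqI:
  "sorted_wrt (<) s \<Longrightarrow> sorted_wrt (<) t \<Longrightarrow> set s = set t \<Longrightarrow> s = (t :: nat list)"
  by (simp add: sorted_distinct_set_unique strict_sorted_iff)

lemma tetrahedra_pentachoron:
  assumes "1 \<le> i" "i < j" "j < k" "k < l" "l < m" "m \<le> (6::nat)"
  shows "tetrahedra [i, j, k, l, m] =
    {[i, j, k, l], [i, j, k, m], [i, j, l, m], [i, k, l, m], [j, k, l, m]}"
proof (intro equalityI subsetI)
  fix t assume "t \<in> tetrahedra [i, j, k, l, m]"
  then have t: "sorted_wrt (<) t" "length t = 4" "set t \<subseteq> {i, j, k, l, m}"
    by (auto simp: tetrahedra_def simplices_def)
  then have "card (set t) = 4"
    by (simp add: strict_sorted_iff distinct_card)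
  then have "card ({i, j, k, l, m} - set t) = 1"
    using t(3) assms by (simp add: card_Diff_subset)
  then obtain v where "{i, j, k, l, m} - set t = {v}"
    by (rule card_1_singletonE)
  then have v: "v \<in> {i, j, k, l, m}" "set t = {i, j, k, l, m} - {v}"
    using t(3) by blast+
  have "t = r" if "sorted_wrt (<) r" "set r = {i, j, k, l, m} - {v}" for r
    using strict_sorted_eqI[of t r] t v that by simp
  moreover have "{i, j, k, l, m} - {i} = {j, k, l, m}" "{i, j, k, l, m} - {j} = {i, k, l, m}"
    "{i, j, k, l, m} - {k} = {i, j, l, m}" "{i, j, k, l, m} - {l} = {i, j, k, m}"
    "{i, j, k, l, m} - {m} = {i, j, k, l}" using assms by auto
  ultimately show "t \<in> {[i, j, k, l], [i, j, k, m], [i, j, l, m], [i, k, l, m], [j, k, l, m]}"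
    using v(1) assms by force
qed (use assms in \<open>auto simp: tetrahedra_def simplices_def\<close>)

lemma simplices_5: "s \<in> simplices 5 \<Longrightarrow> s = whole_simplex"
proof (rule strict_sorted_eqI)
  assume s: "s \<in> simplices 5"
  then have "card (set s) = 6"
    by (auto simp: simplices_def strict_sorted_iff distinct_card)
  then have "set s = {1..6}"
    using s by (intro card_subset_eq) (auto simp: simplices_def)
  moreover have "x \<in> {1..6} \<longleftrightarrow> x \<in> {1, 2, 3, 4, 5, 6}" for x :: nat
    unfolding atLeastAtMost_iff insert_iff empty_iff by presburger
  ultimately show "set s = set whole_simplex" by (simp add: set_eq_iff)
qed (auto simp: simplices_def)

lemma tetrahedra_tetrahedron: "tetrahedra t = {t}" if "t \<in> simplices 3"
proof (intro equalityI subsetI)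
  fix t' assume t': "t' \<in> tetrahedra t"
  then have "set t' = set t"
    using that by (intro card_subset_eq)
      (auto simp: tetrahedra_def simplices_def strict_sorted_iff distinct_card)
  then show "t' \<in> {t}"
    using t' that strict_sorted_eqI[of t' t] by (auto simp: tetrahedra_def simplices_def)
qed (use that in \<open>auto simp: tetrahedra_def\<close>)

lemma lessThan_5: "{..<5} = {0, 1, 2, 3, 4 :: nat}" by auto
lemma lessThan_6: "{..<6} = {0, 1, 2, 3, 4, 5 :: nat}" by auto

definition ratio :: "(nat \<times> nat \<Rightarrow> 'a :: field) \<Rightarrow> (nat \<times> nat \<Rightarrow> 'a) \<Rightarrow> nat \<Rightarrow> nat \<Rightarrow> nat \<Rightarrow> 'a" where
  "ratio b a i j k = omega a i j k / omega b i j k"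

text \<open>
  The logarithmic derivative of \<open>\<omega>\<close> in the direction \<open>a\<close>, transported to a color of each
  tetrahedron.
\<close>

fun variation_coloring ::
  "(nat \<times> nat \<Rightarrow> 'a :: field) \<Rightarrow> (nat \<times> nat \<Rightarrow> 'a) \<Rightarrow> 'a coloring" where
  "variation_coloring b a [i, j, k, l] =
    ((ratio b a i j l - ratio b a i j k) / (omega b i j k - omega b i j l),
     (ratio b a j k l - ratio b a i k l) / (omega b i j k - omega b i j l))"
| "variation_coloring b a _ = 0"

declare variation_coloring.simps(1) [simp del]

definition row_value :: "(nat \<times> nat \<Rightarrow> 'a :: field) \<Rightarrow> nat list \<Rightarrow> nat \<times> nat \<Rightarrow> 'a \<times> 'a \<Rightarrow> 'a" where
  "row_value b t e v = fst (edge_row b t e) * fst v + snd (edge_row b t e) * snd v"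

definition triangle_boundary :: "nat \<Rightarrow> nat \<Rightarrow> nat \<Rightarrow> nat \<times> nat \<Rightarrow> 'a :: field" where
  "triangle_boundary i j k e = of_bool (e = (i, j)) - of_bool (e = (i, k)) + of_bool (e = (j, k))"

lemma omega_cocycle:
  "omega b j k l - omega b i k l + omega b i j l - omega b i j k = 0"
  by (simp add: omega_def)

lemma omega_add: "omega (\<lambda>e. a e + a' e) i j k = omega a i j k + omega a' i j k"
  by (simp add: omega_def algebra_simps)

lemma omega_scale: "omega (\<lambda>e. c * a e) i j k = c * omega a i j k"
  by (simp add: omega_def algebra_simps)

text \<open>
  Since the row of an edge outside a tetrahedron is zero, the sum may run over all five faces.
\<close>

lemma edge_functional_pentachoron:
  assumes "i < j" "j < k" "k < l" "l < m"
  shows "edge_functional b [i, j, k, l, m] e x =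
    row_value b [j, k, l, m] e (x [j, k, l, m]) - row_value b [i, k, l, m] e (x [i, k, l, m])
    + row_value b [i, j, l, m] e (x [i, j, l, m]) - row_value b [i, j, k, m] e (x [i, j, k, m])
    + row_value b [i, j, k, l] e (x [i, j, k, l])"
proof -
  let ?u = "[i, j, k, l, m]"
  have zero: "row_value b t e v = 0" if "e \<notin> edges t" "t = [p, q, r, s]" "p < q" "q < r" "r < s"
    for t v p q r s
    using that by (auto simp: row_value_def edges_def)
  have "edge_functional b ?u e x = (\<Sum>n<5. (-1) ^ n * row_value b (omit n ?u) e (x (omit n ?u)))"
    unfolding edge_functional_def row_value_def[symmetric]
  proof (rule sum.mono_neutral_left)
    show "\<forall>n\<in>{..<5} - {n. n < length ?u \<and> e \<in> edges (omit n ?u)}.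
        (-1) ^ n * row_value b (omit n ?u) e (x (omit n ?u)) = 0"
      using assms by (auto simp: omit_def lessThan_nat_numeral lessThan_Suc intro!: zero)
  qed auto
  then show ?thesis by (simp add: lessThan_5 omit_def)
qed

lemma omega_indicator: "omega (\<lambda>e. of_bool (e = f)) i j k = triangle_boundary i j k f"
  by (auto simp: omega_def triangle_boundary_def)

section \<open>Permitted colorings from variations of the edge values\<close>

locale generic_values =
  fixes b :: "nat \<times> nat \<Rightarrow> 'a :: field"
  assumes omega_nonzero: "1 \<le> i \<Longrightarrow> i < j \<Longrightarrow> j < k \<Longrightarrow> k \<le> 6 \<Longrightarrow> omega b i j k \<noteq> 0"
    and omega_distinct:
      "1 \<le> i \<Longrightarrow> i < j \<Longrightarrow> j < k \<Longrightarrow> k < l \<Longrightarrow> l \<le> 6 \<Longrightarrow> omega b i j k \<noteq> omega b i j l"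
begin

lemma omega_times_ratio:
  "1 \<le> i \<Longrightarrow> i < j \<Longrightarrow> j < k \<Longrightarrow> k \<le> 6 \<Longrightarrow> omega b i j k * ratio b a i j k = omega a i j k"
  using omega_nonzero by (simp add: ratio_def)

text \<open>
  The rows of \<open>ij\<close> and \<open>ik\<close> alone determine a color, and unlike the quotients in the definition
  they involve \<open>h\<close> only on triangles through \<open>i\<close>; this makes it possible to build \<open>a\<close>
  outwards from \<open>i\<close>.  Passing from one pair of equations to the other uses that \<open>\<omega>(a)\<close> is a cocycle.
\<close>

lemma variation_coloring_iff:
  assumes "1 \<le> i" "i < j" "j < k" "k < l" "l \<le> 6"
  shows "variation_coloring b a [i, j, k, l] = v \<longleftrightarrow>
    (omega b i j k - omega b i j l) * fst v = ratio b a i j l - ratio b a i j k \<and>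
    omega b i j l * fst v + omega b j k l * snd v = ratio b a i j k - ratio b a i k l"
proof -
  define D where "D = omega b i j k - omega b i j l"
  have D: "D \<noteq> 0" using omega_distinct assms by (simp add: D_def)
  have w: "omega b j k l \<noteq> 0" using omega_nonzero assms by simp
  have D': "D = omega b j k l - omega b i k l"
    using omega_cocycle[of b j k l i] by (simp add: D_def algebra_simps)
  have "omega a j k l - omega a i k l + omega a i j l - omega a i j k = 0"
    by (rule omega_cocycle)
  then have eta: "omega b j k l * ratio b a j k l - omega b i k l * ratio b a i k l
      + omega b i j l * ratio b a i j l - omega b i j k * ratio b a i j k = 0"
    using assms by (simp add: omega_times_ratio)
  \<comment> \<open>The cocycle condition of \<open>a\<close>, multiplied out with \<open>h\<close>.\<close>
  have key: "omega b i j l * (ratio b a i j l - ratio b a i j k)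
      + omega b j k l * (ratio b a j k l - ratio b a i k l) = D * (ratio b a i j k - ratio b a i k l)"
  proof -
    have 1: "omega b i k l = omega b j k l - D" using D' by simp
    have 2: "omega b i j k = omega b i j l + D" by (simp add: D_def)
    show ?thesis using eta unfolding 1 2 by (simp add: algebra_simps)
  qed
  obtain x y where v: "v = (x, y)" by (cases v)
  have "variation_coloring b a [i, j, k, l] = v \<longleftrightarrow>
      D * x = ratio b a i j l - ratio b a i j k \<and> D * y = ratio b a j k l - ratio b a i k l"
    using D by (auto simp: variation_coloring.simps v D_def[symmetric] field_simps)
  also have "\<dots> \<longleftrightarrow> D * x = ratio b a i j l - ratio b a i j k \<and>
      omega b i j l * x + omega b j k l * y = ratio b a i j k - ratio b a i k l"
  proof (rule conj_cong[OF refl])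
    assume x: "D * x = ratio b a i j l - ratio b a i j k"
    have "omega b i j l * x + omega b j k l * y = ratio b a i j k - ratio b a i k l \<longleftrightarrow>
      D * (omega b i j l * x + omega b j k l * y) = D * (ratio b a i j k - ratio b a i k l)"
      using D by simp
    also have "\<dots> \<longleftrightarrow> omega b i j l * (D * x) + omega b j k l * (D * y) =
        omega b i j l * (ratio b a i j l - ratio b a i j k)
      + omega b j k l * (ratio b a j k l - ratio b a i k l)"
      unfolding key by (simp add: algebra_simps)
    also have "\<dots> \<longleftrightarrow> D * y = ratio b a j k l - ratio b a i k l"
      using w by (simp add: x)
    finally show "D * y = ratio b a j k l - ratio b a i k l \<longleftrightarrow>
       omega b i j l * x + omega b j k l * y = ratio b a i j k - ratio b a i k l" by simp
  qed
  finally show ?thesis by (simp add: v D_def)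
qed

text \<open>
  The color of a tetrahedron \<open>t\<close> encodes the 1-cycle \<open>\<Sum>\<^sub>f \<plusminus> h\<^sub>f \<partial>f\<close>, where the sum is over the faces
  of \<open>t\<close>.
\<close>

lemma row_value_variation_coloring:
  assumes "1 \<le> i" "i < j" "j < k" "k < l" "l \<le> 6"
  shows "row_value b [i, j, k, l] e (variation_coloring b a [i, j, k, l]) =
    ratio b a j k l * triangle_boundary j k l e - ratio b a i k l * triangle_boundary i k l e
    + ratio b a i j l * triangle_boundary i j l e - ratio b a i j k * triangle_boundary i j k e"
proof -
  obtain x y where xy: "variation_coloring b a [i, j, k, l] = (x, y)" by force
  define D where "D = omega b i j k - omega b i j l"
  have D: "D \<noteq> 0" using omega_distinct assms by (simp add: D_def)
  have "(omega b i j k - omega b i j l) * x = ratio b a i j l - ratio b a i j k"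
    and z: "omega b i j l * x + omega b j k l * y = ratio b a i j k - ratio b a i k l"
    using xy assms by (simp_all only: variation_coloring_iff fst_conv snd_conv)
  then have x: "D * x = ratio b a i j l - ratio b a i j k" by (simp add: D_def)
  have y: "D * y = ratio b a j k l - ratio b a i k l"
    using xy D by (auto simp: variation_coloring.simps D_def[symmetric])
  have w: "omega b i j k = D + omega b i j l" "omega b i k l = omega b j k l - D"
    using omega_cocycle[of b j k l i] by (simp_all add: D_def algebra_simps)
  have "row_value b [i, j, k, l] (i, j) (x, y) = D * x"
    "row_value b [i, j, k, l] (i, k) (x, y) = omega b i j l * x + omega b j k l * y"
    "row_value b [i, j, k, l] (i, l) (x, y) = - D * x - (omega b i j l * x + omega b j k l * y)"
    "row_value b [i, j, k, l] (j, k) (x, y) = D * y - (omega b i j l * x + omega b j k l * y)"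
    "row_value b [i, j, k, l] (j, l) (x, y) = D * x - D * y + (omega b i j l * x + omega b j k l * y)"
    "row_value b [i, j, k, l] (k, l) (x, y) = D * y"
    using assms by (simp_all add: row_value_def w algebra_simps)
  note rows = this[unfolded x y z mult_minus_left]
  consider "e = (i, j)" | "e = (i, k)" | "e = (i, l)" | "e = (j, k)" | "e = (j, l)" | "e = (k, l)"
    | "e \<notin> {(i, j), (i, k), (i, l), (j, k), (j, l), (k, l)}" by blast
  then show ?thesis
    unfolding xy using assms
    by cases (simp_all add: rows triangle_boundary_def, simp_all add: row_value_def)
qed

text \<open>
  By the previous lemma the functional is a signed sum over pairs of a tetrahedron and one of its faces,
  which cancels as in \<open>\<delta>\<delta> = 0\<close>.
\<close>

lemma edge_functional_variation_coloring:
  assumes "1 \<le> i" "i < j" "j < k" "k < l" "l < m" "m \<le> 6"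
  shows "edge_functional b [i, j, k, l, m] e (variation_coloring b a) = 0"
  using assms
  by (simp add: edge_functional_pentachoron row_value_variation_coloring)

text \<open>
  The functionals of \<open>ik\<close> and \<open>il\<close> involve only one unknown tetrahedron, \<open>iklm\<close>, and their rows there
  are independent; once it is known, \<open>jk\<close> and \<open>jl\<close> do the same for \<open>jklm\<close>.
\<close>

lemma pentachoron_rigid:
  assumes ijklm: "1 \<le> i" "i < j" "j < k" "k < l" "l < m" "m \<le> 6"
    and functionals: "\<And>e. e \<in> edges [i, j, k, l, m] \<Longrightarrow>
      edge_functional b [i, j, k, l, m] e x = edge_functional b [i, j, k, l, m] e y"
    and agree: "x [i, j, k, l] = y [i, j, k, l]" "x [i, j, k, m] = y [i, j, k, m]"
      "x [i, j, l, m] = y [i, j, l, m]"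
  shows "x [i, k, l, m] = y [i, k, l, m]" "x [j, k, l, m] = y [j, k, l, m]"
proof -
  have determined: "v = w" if "1 \<le> p" "p < q" "q < r" "r < s" "s \<le> 6"
    "row_value b [p, q, r, s] (p, q) v = row_value b [p, q, r, s] (p, q) w"
    "row_value b [p, q, r, s] (p, r) v = row_value b [p, q, r, s] (p, r) w" for p q r s v w
  proof -
    have "omega b q r s \<noteq> omega b p r s"
      using omega_distinct[of p q r s] omega_cocycle[of b q r s p] that by (auto simp: algebra_simps)
    then show ?thesis using that omega_nonzero[of q r s]
      by (auto simp: row_value_def prod_eq_iff)
  qed
  have at_i: "row_value b [i, k, l, m] e (x [i, k, l, m]) = row_value b [i, k, l, m] e (y [i, k, l, m])"
    if "e \<in> {(i, k), (i, l)}" for e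
  proof -
    have "row_value b [j, k, l, m] e v = 0" for v
      using that ijklm by (auto simp: row_value_def)
    then show ?thesis
      using functionals[of e] that ijklm agree
      by (auto simp: edge_functional_pentachoron edges_def)
  qed
  show ikl: "x [i, k, l, m] = y [i, k, l, m]"
    using at_i ijklm by (intro determined[of i k l m]) auto
  show "x [j, k, l, m] = y [j, k, l, m]"
    using functionals[of "(j, k)"] functionals[of "(j, l)"] ijklm agree ikl
    by (intro determined[of j k l m]) (auto simp: edge_functional_pentachoron edges_def)
qed

section \<open>Every permitted coloring is a variation\<close>

text \<open>
  An edge function whose variation is the given coloring, normalized by \<open>a = 0\<close> on the edges at \<open>i\<close>
  and \<open>h\<^sub>i\<^sub>j\<^sub>k = 0\<close>.  Then \<open>a(p, q) = \<omega>\<^sub>i\<^sub>p\<^sub>q(a)\<close>, and the values of \<open>h\<close> follow from the colors of the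
  tetrahedra through \<open>ij\<close>: first on the triangles through \<open>ij\<close>, then on the other ones through \<open>i\<close>.
\<close>

fun lift :: "nat list \<Rightarrow> 'a coloring \<Rightarrow> nat \<times> nat \<Rightarrow> 'a" where
  "lift (i # j # k # s) x (p, q) =
    (let h = (\<lambda>q. if q = k then 0 else (omega b i j k - omega b i j q) * fst (x [i, j, k, q])) in
      if p = i then 0
      else if p = j then omega b i j q * h q
      else omega b i p q *
        (h p - omega b i j q * fst (x [i, j, p, q]) - omega b j p q * snd (x [i, j, p, q])))"
| "lift _ x e = 0"

text \<open>
  The functional of \<open>ij\<close> says that the differences of \<open>h\<close> around the edge \<open>ij\<close> add up to zero, so that
  those not used in constructing the lift are right as well.
\<close>

lemma lift_realizes_link:
  assumes "1 \<le> i" "i < j" "j < k" "k \<le> p" "p < q" "q \<le> 6"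
    and "k < p \<Longrightarrow> edge_functional b [i, j, k, p, q] (i, j) x = 0"
  shows "variation_coloring b (lift (i # j # k # s) x) [i, j, p, q] = x [i, j, p, q]"
proof -
  define h where "h = (\<lambda>q. if q = k then 0 else (omega b i j k - omega b i j q) * fst (x [i, j, k, q]))"
  have "ratio b (lift (i # j # k # s) x) i j r = h r" if "k \<le> r" "r \<le> 6" for r
    using that assms omega_nonzero[of i j r] by (simp add: ratio_def omega_def[of "lift _ _"] h_def)
  moreover have "ratio b (lift (i # j # k # s) x) i p q =
      h p - omega b i j q * fst (x [i, j, p, q]) - omega b j p q * snd (x [i, j, p, q])"
    using assms omega_nonzero[of i p q] by (simp add: ratio_def omega_def[of "lift _ _"] h_def)
  moreover have "(omega b i j p - omega b i j q) * fst (x [i, j, p, q]) = h q - h p"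
  proof (cases "p = k")
    case False
    have D: "omega b j r s - omega b i r s = omega b i j r - omega b i j s" for r s
      by (simp add: omega_def)
    have "u = v - w" if "u - v + w = 0" for u v w :: 'a
      using that by (simp add: eq_diff_eq diff_add_eq)
    then show ?thesis
      using assms False
      by (simp add: edge_functional_pentachoron row_value_def h_def D)
  qed (use assms in \<open>simp add: h_def\<close>)
  ultimately show ?thesis
    using assms by (subst variation_coloring_iff) simp_all
qed

lemma pentachoron_realized:
  assumes "1 \<le> i" "i < j" "j < k" "k < l" "l < m" "m \<le> 6"
    and "\<And>e. e \<in> edges [i, j, k, l, m] \<Longrightarrow> edge_functional b [i, j, k, l, m] e x = 0"
    and "variation_coloring b a [i, j, k, l] = x [i, j, k, l]"
      "variation_coloring b a [i, j, k, m] = x [i, j, k, m]"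
      "variation_coloring b a [i, j, l, m] = x [i, j, l, m]"
  shows "variation_coloring b a [i, k, l, m] = x [i, k, l, m]"
    "variation_coloring b a [j, k, l, m] = x [j, k, l, m]"
  using pentachoron_rigid[of i j k l m "variation_coloring b a" x] assms
  by (simp_all add: edge_functional_variation_coloring)

text \<open>
  The tetrahedra through \<open>12\<close> are right by construction; by rigidity this spreads to those through 1
  or 2, and from those through 1 to all others.
\<close>

lemma whole_lift:
  assumes "x \<in> permitted b whole_simplex" "t \<in> simplices 3"
  shows "variation_coloring b (lift whole_simplex x) t = x t"
proof -
  have ef: "edge_functional b [i, j, k, l, m] e x = 0"
    if "1 \<le> i" "i < j" "j < k" "k < l" "l < m" "m \<le> 6" "e \<in> edges [i, j, k, l, m]" for i j k l m e
  proof -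
    have "{i, j, k, l, m} \<subseteq> {1, 2, 3, 4, 5, 6}" using that by auto
    moreover have "[i, j, k, l, m] \<in> simplices 4" using that by (auto simp: simplices_def)
    ultimately show ?thesis using assms(1) that by (auto simp: permitted_def)
  qed
  define a where "a = lift whole_simplex x"
  have start_12: "variation_coloring b a [1, 2, p, q] = x [1, 2, p, q]" if "2 < p" "p < q" "q \<le> 6" for p q
    unfolding a_def by (rule lift_realizes_link) (use that in \<open>auto intro!: ef simp: edges_def\<close>)
  have start_1: "variation_coloring b a [1, p, q, r] = x [1, p, q, r]"
    if "2 < p" "p < q" "q < r" "r \<le> 6" for p q r
    using that by - (rule pentachoron_realized(1)[of 1 2]; (rule start_12 | rule ef)?; (assumption | simp))
  have start_2: "variation_coloring b a [2, p, q, r] = x [2, p, q, r]"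
    if "2 < p" "p < q" "q < r" "r \<le> 6" for p q r
    using that by - (rule pentachoron_realized(2)[of 1 2]; (rule start_12 | rule ef)?; (assumption | simp))
  have start_later: "variation_coloring b a [p, q, r, s] = x [p, q, r, s]"
    if "2 < p" "p < q" "q < r" "r < s" "s \<le> 6" for p q r s
    using that by - (rule pentachoron_realized(2)[of 1 p]; (rule start_1 | rule ef)?; (assumption | simp))
  obtain i j k l where t: "t = [i, j, k, l]" "1 \<le> i" "i < j" "j < k" "k < l" "l \<le> 6"
    using assms(2) by (rule tetrahedron_cases)
  then consider "i = 1" "j = 2" | "i = 1" "j > 2" | "i = 2" | "i > 2" by linarith
  then show ?thesis
    unfolding a_def[symmetric] t(1)
  proof cases
    case 1
    show "variation_coloring b a [i, j, k, l] = x [i, j, k, l]"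
      unfolding 1 by (rule start_12) (use 1 t in simp_all)
  next
    case 2
    show "variation_coloring b a [i, j, k, l] = x [i, j, k, l]"
      unfolding 2(1) by (rule start_1) (use 2 t in simp_all)
  next
    case 3
    show "variation_coloring b a [i, j, k, l] = x [i, j, k, l]"
      unfolding 3 by (rule start_2) (use 3 t in simp_all)
  next
    case 4
    show "variation_coloring b a [i, j, k, l] = x [i, j, k, l]"
      by (rule start_later) (use 4 t in simp_all)
  qed
qed

lemma pentachoron_lift:
  assumes u: "1 \<le> i" "i < j" "j < k" "k < l" "l < m" "m \<le> 6"
    and x: "x \<in> permitted b [i, j, k, l, m]" and t: "t \<in> tetrahedra [i, j, k, l, m]"
  shows "variation_coloring b (lift [i, j, k, l, m] x) t = x t"
proof -
  have ef: "edge_functional b [i, j, k, l, m] e x = 0" if "e \<in> edges [i, j, k, l, m]" for e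
    using x that u by (auto simp: permitted_def simplices_def)
  define a where "a = lift [i, j, k, l, m] x"
  have ij: "variation_coloring b a [i, j, k, l] = x [i, j, k, l]"
      "variation_coloring b a [i, j, k, m] = x [i, j, k, m]"
      "variation_coloring b a [i, j, l, m] = x [i, j, l, m]"
    unfolding a_def using u by (intro lift_realizes_link ef; simp add: edges_def)+
  then show ?thesis
    using pentachoron_realized[OF u ef ij] t u
    by (auto simp: tetrahedra_pentachoron a_def)
qed

end

section \<open>The corrected cup product\<close>

definition cup :: "(nat \<times> nat \<Rightarrow> 'a :: field) \<Rightarrow> (nat \<times> nat \<Rightarrow> 'a) \<Rightarrow> nat list \<Rightarrow> 'a" where
  "cup a a' s = omega a (s ! 0) (s ! 1) (s ! 2) * omega a' (s ! 2) (s ! 3) (s ! 4)"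

text \<open>
  A form whose value at \<open>a' = b\<close> is a 3-cochain with the coboundary \<open>\<omega>(b) \<smile> \<omega>(a) + \<omega>(a) \<smile> \<omega>(b)\<close>.
\<close>

definition correction ::
  "(nat \<times> nat \<Rightarrow> 'a :: field) \<Rightarrow> (nat \<times> nat \<Rightarrow> 'a) \<Rightarrow> (nat \<times> nat \<Rightarrow> 'a) \<Rightarrow> nat list \<Rightarrow> 'a" where
  "correction b a a' t =
    b (t ! 0, t ! 1) * (omega a (t ! 1) (t ! 2) (t ! 3) * omega a' (t ! 1) (t ! 2) (t ! 3)
       / omega b (t ! 1) (t ! 2) (t ! 3)) +
    b (t ! 2, t ! 3) * (omega a (t ! 0) (t ! 1) (t ! 2) * omega a' (t ! 0) (t ! 1) (t ! 2)
       / omega b (t ! 0) (t ! 1) (t ! 2))"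

definition cocycle_form ::
  "(nat \<times> nat \<Rightarrow> 'a :: field) \<Rightarrow> nat list \<Rightarrow> (nat \<times> nat \<Rightarrow> 'a) \<Rightarrow> (nat \<times> nat \<Rightarrow> 'a) \<Rightarrow> 'a" where
  "cocycle_form b u a a' =
    cup a a' u + cup a' a u - (\<Sum>m<5. (-1) ^ m * correction b a a' (omit m u))"

lemma cocycle_form_commute: "cocycle_form b u a a' = cocycle_form b u a' a"
  by (simp add: cocycle_form_def correction_def ac_simps)

lemma cocycle_form_add:
  "cocycle_form b u (\<lambda>e. a e + a' e) a'' = cocycle_form b u a a'' + cocycle_form b u a' a''"
  unfolding cocycle_form_def cup_def correction_def omega_add
  by (simp add: algebra_simps add_divide_distrib sum.distrib)

lemma cocycle_form_scale:
  "cocycle_form b u (\<lambda>e. c * a e) a' = c * cocycle_form b u a a'"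
  unfolding cocycle_form_def cup_def correction_def omega_scale
  by (simp add: algebra_simps sum_distrib_left)

lemma cocycle_form_cong:
  assumes "\<And>p q r. [p, q, r] \<in> {[i,j,k],[i,j,l],[i,j,m],[i,k,l],[i,k,m],[i,l,m],[j,k,l],[j,k,m],[j,l,m],[k,l,m]}
     \<Longrightarrow> omega a p q r = omega a' p q r"
  shows "cocycle_form b [i, j, k, l, m] a c = cocycle_form b [i, j, k, l, m] a' c"
  using assms by (simp add: cocycle_form_def lessThan_5 cup_def correction_def omit_def)

text \<open>
  The cup product of two cocycles is closed, and the correction enters through a coboundary.
\<close>

lemma coboundary_cocycle_form:
  "(\<Sum>m<6. (-1) ^ m * cocycle_form b (omit m [i, j, k, l, p, q]) a a') = 0"
proof -
  have "(\<Sum>m<6. (-1) ^ m * cup a a' (omit m [i, j, k, l, p, q])) = 0" for a a' :: "nat \<times> nat \<Rightarrow> 'a"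
  proof -
    have left: "omega a j k l = omega a i k l - omega a i j l + omega a i j k"
      and right: "omega a' l p q = omega a' k p q - omega a' k l q + omega a' k l p"
      by (simp_all add: omega_def)
    show ?thesis
      by (simp add: lessThan_6 cup_def omit_def left right algebra_simps)
  qed
  moreover have "(\<Sum>m<6. (-1) ^ m * (\<Sum>n<5. (-1) ^ n *
     correction b a a' (omit n (omit m [i, j, k, l, p, q])))) = 0"
    by (simp add: lessThan_6 lessThan_5 omit_def)
  ultimately show ?thesis
    unfolding cocycle_form_def right_diff_distrib distrib_left sum.distrib sum_subtractf by simp
qed

context generic_values
begin

text \<open>
  Equal colors mean equal differences of \<open>h\<close>, so within a tetrahedron \<open>h\<close> changes by a constant.
\<close>

lemma same_coloring_ratio:
  assumes "1 \<le> i" "i < j" "j < k" "k < l" "l \<le> 6"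
    and "variation_coloring b a [i, j, k, l] = variation_coloring b a' [i, j, k, l]"
  defines "d \<equiv> \<lambda>i j k. ratio b a i j k - ratio b a' i j k"
  shows "d i j l = d i j k" "d i k l = d i j k" "d j k l = d i j k"
proof -
  have eq: "ratio b a i j l - ratio b a i j k = ratio b a' i j l - ratio b a' i j k"
    "ratio b a i j k - ratio b a i k l = ratio b a' i j k - ratio b a' i k l"
    using iffD1[OF variation_coloring_iff[OF assms(1-5)] refl, of a, unfolded assms(6)]
      iffD1[OF variation_coloring_iff[OF assms(1-5)] refl, of a'] by (simp_all only:)
  have eq': "ratio b a j k l - ratio b a i k l = ratio b a' j k l - ratio b a' i k l"
    using assms(6) omega_distinct[of i j k l] assms(1-5) by (simp add: variation_coloring.simps)
  show ijl: "d i j l = d i j k" and ikl: "d i k l = d i j k"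
    using eq by (simp_all add: d_def algebra_simps)
  have "d j k l = d i k l"
    using eq' by (simp add: d_def algebra_simps)
  then show "d j k l = d i j k" by (simp add: ikl)
qed

text \<open>
  The cup products with \<open>\<omega>(b) = \<delta>b\<close> are coboundaries of \<open>b \<smile> \<omega>(a)\<close> and \<open>\<omega>(a) \<smile> b\<close>, and the
  correction contributes exactly these.
\<close>

lemma cocycle_form_radical:
  assumes "1 \<le> i" "i < j" "j < k" "k < l" "l < m" "m \<le> 6"
  shows "cocycle_form b [i, j, k, l, m] b a = 0"
proof -
  have 1: "correction b b a [p, q, r, s] = b (p, q) * omega a q r s + b (r, s) * omega a p q r"
    if "1 \<le> p" "p < q" "q < r" "r < s" "s \<le> 6" for p q r s
    using that omega_nonzero by (simp add: correction_def)
  have a345: "omega a k l m = omega a j l m - omega a j k m + omega a j k l"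
    and a123: "omega a i j k = omega a j k l - omega a i k l + omega a i j l"
    by (simp_all add: omega_def)
  show ?thesis using assms
    by (simp add: cocycle_form_def lessThan_5 omit_def 1 cup_def a345 a123)
      (simp add: omega_def[of b] algebra_simps)
qed

text \<open>
  Adjacent tetrahedra share a triangle, so the constants by which \<open>h\<close> changes in the tetrahedra agree:
  \<open>\<omega>(a)\<close> changes by a multiple of \<open>\<omega>(b)\<close>, which lies in the radical.
\<close>

lemma cocycle_form_well_defined:
  assumes "1 \<le> i" "i < j" "j < k" "k < l" "l < m" "m \<le> 6"
    and eq: "\<And>t. t \<in> {[i, j, k, l], [i, j, k, m], [i, j, l, m], [i, k, l, m], [j, k, l, m]} \<Longrightarrow>
      variation_coloring b a t = variation_coloring b a' t"
  shows "cocycle_form b [i, j, k, l, m] a c = cocycle_form b [i, j, k, l, m] a' c"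
proof -
  define c0 where "c0 = ratio b a i j k - ratio b a' i j k"
  have shift: "omega a p q r = omega (\<lambda>e. a' e + c0 * b e) p q r"
    if "ratio b a p q r - ratio b a' p q r = c0" "1 \<le> p" "p < q" "q < r" "r \<le> 6" for p q r
  proof -
    have "ratio b a p q r = c0 + ratio b a' p q r"
      using that(1) by (simp add: algebra_simps)
    then have "omega a p q r = omega b p q r * (c0 + ratio b a' p q r)"
      using omega_times_ratio[of p q r a] that by simp
    then show ?thesis
      using that by (simp add: distrib_left omega_times_ratio omega_add omega_scale mult.commute)
  qed
  have d: "ratio b a p q s - ratio b a' p q s = ratio b a p q r - ratio b a' p q r"
    "ratio b a p r s - ratio b a' p r s = ratio b a p q r - ratio b a' p q r"
    "ratio b a q r s - ratio b a' q r s = ratio b a p q r - ratio b a' p q r"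
    if "1 \<le> p" "p < q" "q < r" "r < s" "s \<le> 6"
      "[p, q, r, s] \<in> {[i, j, k, l], [i, j, k, m], [i, j, l, m], [i, k, l, m], [j, k, l, m]}"
    for p q r s
    using same_coloring_ratio[OF that(1-5) eq[OF that(6)]] by simp_all
  have "omega a p q r = omega (\<lambda>e. a' e + c0 * b e) p q r"
    if "[p, q, r] \<in> {[i, j, k], [i, j, l], [i, j, m], [i, k, l], [i, k, m], [i, l, m],
      [j, k, l], [j, k, m], [j, l, m], [k, l, m]}" for p q r
  proof (rule shift)
    show "ratio b a p q r - ratio b a' p q r = c0"
      using that assms(1-6) d[of i j k l] d[of i j k m] d[of i j l m] d[of i k l m] d[of j k l m]
      by (auto simp: c0_def)
  qed (use that assms(1-6) in auto)
  then have "cocycle_form b [i, j, k, l, m] a c = cocycle_form b [i, j, k, l, m] (\<lambda>e. a' e + c0 * b e) c"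
    by (rule cocycle_form_cong)
  then show ?thesis
    using assms(1-6) by (simp add: cocycle_form_add cocycle_form_scale cocycle_form_radical)
qed

section \<open>Closedness\<close>

definition cocycle :: "'a cochain" where
  "cocycle u x y = cocycle_form b u (lift u x) (lift u y)"

lemma lift_add: "lift s (x + y) = (\<lambda>e. lift s x e + lift s y e)"
proof
  fix e show "lift s (x + y) e = lift s x e + lift s y e"
    by (cases "(s, x, e)" rule: lift.cases) (auto simp: Let_def algebra_simps)
qed

lemma lift_scale: "lift s (scale c x) = (\<lambda>e. c * lift s x e)"
proof
  fix e show "lift s (scale c x) e = c * lift s x e"
    by (cases "(s, x, e)" rule: lift.cases) (auto simp: Let_def scale_def algebra_simps)
qed

lemma symmetric_bilinear_on_cocycle: "symmetric_bilinear_on V (cocycle s)"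
  unfolding symmetric_bilinear_on_def cocycle_def lift_add lift_scale cocycle_form_add
    cocycle_form_scale
  by (auto intro: cocycle_form_commute)

text \<open>
  The lifts used on a pentachoron need not be restrictions of a lift for \<open>\<Delta>\<^sup>5\<close>; independence of the
  choice of lift is what relates the six faces.
\<close>

lemma cocycle_eq_form:
  assumes u: "u \<in> simplices 4" and perm: "x \<in> permitted b u" "y \<in> permitted b u"
    and real: "\<And>t. t \<in> tetrahedra u \<Longrightarrow> variation_coloring b a t = x t"
      "\<And>t. t \<in> tetrahedra u \<Longrightarrow> variation_coloring b a' t = y t"
  shows "cocycle u x y = cocycle_form b u a a'"
proof -
  obtain i j k l m where ul: "u = [i, j, k, l, m]"
    and le: "1 \<le> i" "i < j" "j < k" "k < l" "l < m" "m \<le> 6"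
    using u by (rule pentachoron_cases)
  have wd: "cocycle_form b u (lift u z) c = cocycle_form b u a'' c"
    if "z \<in> permitted b u" "\<And>t. t \<in> tetrahedra u \<Longrightarrow> variation_coloring b a'' t = z t" for z a'' c
    unfolding ul by (rule cocycle_form_well_defined[OF le])
      (metis le pentachoron_lift tetrahedra_pentachoron that ul)
  show ?thesis
    unfolding cocycle_def using wd[OF perm(1) real(1)] wd[OF perm(2) real(2)]
    by (metis cocycle_form_commute)
qed

lemma permitted_restriction:
  assumes "\<And>u e. u \<in> simplices 4 \<Longrightarrow> set u \<subseteq> set s \<Longrightarrow> e \<in> edges u \<Longrightarrow> edge_functional b u e x = 0"
  shows "restriction s x \<in> permitted b s"
  unfolding permitted_def
proof (intro CollectI conjI ballI impI)
  show "restriction s x \<in> colorings s" by (auto simp: colorings_def restriction_def)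
  fix u e assume u: "u \<in> simplices 4" "set u \<subseteq> set s" "e \<in> edges u"
  then obtain i j k l m where ul: "u = [i, j, k, l, m]"
    and le: "1 \<le> i" "i < j" "j < k" "k < l" "l < m" "m \<le> 6"
    by (auto elim: pentachoron_cases)
  have tet: "tetrahedra u \<subseteq> tetrahedra s"
    using u by (auto simp: tetrahedra_def)
  then have "edge_functional b u e (restriction s x) = edge_functional b u e x"
    using le unfolding ul by (simp add: edge_functional_pentachoron tetrahedra_pentachoron restriction_def)
  then show "edge_functional b u e (restriction s x) = 0"
    using assms u by (simp add: ul)
qed

lemma cocycle_closed: "cochain_eq b 5 (coboundary cocycle) (\<lambda>s x y. 0)"
proof -
  have "coboundary cocycle s x y = 0"
    if s: "s \<in> simplices 5" and x: "x \<in> permitted b s" and y: "y \<in> permitted b s" for s x y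
  proof -
    have "s = whole_simplex" using s by (rule simplices_5)
    let ?a = "lift whole_simplex"
    have "cocycle (omit m s) (restriction (omit m s) x) (restriction (omit m s) y) =
        cocycle_form b (omit m s) (?a x) (?a y)" if "m < 6" for m
    proof (rule cocycle_eq_form)
      have "omit m whole_simplex \<in> simplices 4 \<and> set (omit m whole_simplex) \<subseteq> set whole_simplex"
        using that by (auto simp: simplices_def omit_def eval_nat_numeral less_Suc_eq)
      then have face: "omit m s \<in> simplices 4" "set (omit m s) \<subseteq> set s"
        unfolding \<open>s = _\<close> by auto
      show "omit m s \<in> simplices 4" by (rule face)
      have "restriction (omit m s) z \<in> permitted b (omit m s)" if "z \<in> permitted b s" for z
        by (rule permitted_restriction) (use that face in \<open>unfold permitted_def, blast\<close>)
      then show "restriction (omit m s) x \<in> permitted b (omit m s)"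
        "restriction (omit m s) y \<in> permitted b (omit m s)"
        using x y by blast+
      have "variation_coloring b (?a z) t = restriction (omit m s) z t"
        if "z \<in> permitted b s" "t \<in> tetrahedra (omit m s)" for z t
        using whole_lift that \<open>s = _\<close> by (auto simp: restriction_def tetrahedra_def)
      then show "variation_coloring b (?a x) t = restriction (omit m s) x t"
        "variation_coloring b (?a y) t = restriction (omit m s) y t"
        if "t \<in> tetrahedra (omit m s)" for t
        using x y that by blast+
    qed
    then have "coboundary cocycle s x y =
        (\<Sum>m<6. (-1) ^ m * cocycle_form b (omit m s) (?a x) (?a y))"
      unfolding coboundary_def using s by (intro sum.cong) (auto simp: simplices_def)
    then show ?thesis
      by (simp only: \<open>s = _\<close> coboundary_cocycle_form)
  qed
  then show ?thesis by (simp add: cochain_eq_def)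
qed

section \<open>Nontriviality\<close>

lemma permitted_tetrahedron:
  assumes "t \<in> simplices 3"
  shows "permitted b t = colorings t"
proof -
  have "\<not> set u \<subseteq> set t" if "u \<in> simplices 4" for u
  proof
    assume "set u \<subseteq> set t"
    then have "card (set u) \<le> card (set t)" by (simp add: card_mono)
    then show False
      using that assms by (simp add: simplices_def strict_sorted_iff distinct_card)
  qed
  then show ?thesis by (auto simp: permitted_def)
qed

definition edge_coloring :: "nat \<Rightarrow> nat \<Rightarrow> 'a coloring" where
  "edge_coloring p q = variation_coloring b (\<lambda>e. of_bool (e = (p, q)))"

lemma edge_coloring_outside:
  assumes "t \<in> simplices 3" "\<not> {p, q} \<subseteq> set t"
  shows "restriction t (edge_coloring p q) = 0"
proof
  fix t'
  show "restriction t (edge_coloring p q) t' = 0 t'"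
  proof (cases "t' \<in> tetrahedra t")
    case True
    then obtain i j k l where "t' = [i, j, k, l]" "{i, j, k, l} \<subseteq> set t"
      by (auto simp: tetrahedra_def elim: tetrahedron_cases)
    moreover have "triangle_boundary x y z (p, q) = (0 :: 'a)" if "{x, y, z} \<subseteq> set t" for x y z
      using that assms(2) by (auto simp: triangle_boundary_def)
    ultimately show ?thesis
      by (simp add: edge_coloring_def variation_coloring.simps ratio_def omega_indicator
        restriction_def zero_prod_def)
  qed (simp add: restriction_def)
qed

text \<open>
  The alternating sum \<open>L\<close> over the three pairs of opposite edges of \<open>2345\<close> separates the cocycle from
  the coboundaries.
\<close>

lemma cocycle_not_coboundary:
  "\<not> (\<exists>d. symmetric_bilinear_cochain b 3 d \<and> cochain_eq b 4 cocycle (coboundary d))"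
proof (intro notI, elim exE conjE)
  fix d :: "'a cochain"
  assume d: "symmetric_bilinear_cochain b 3 d" and eq: "cochain_eq b 4 cocycle (coboundary d)"
  define u where "u = [1, 2, 3, 4, 5 :: nat]"
  define X where "X p q = restriction u (edge_coloring p q)" for p q
  define Y where "Y t p q = restriction t (edge_coloring p q)" for t p q
  define L where "L B = B (2, 3) (4, 5) - B (2, 4) (3, 5) + B (2, 5) (3, 4)"
    for B :: "nat \<times> nat \<Rightarrow> nat \<times> nat \<Rightarrow> 'a"
  have length_u: "length u = 5" by (simp add: u_def)
  have u: "u \<in> simplices 4" by (simp add: u_def simplices_def)
  have faces: "omit m u \<in> simplices 3" "set (omit m u) \<subseteq> set u" if "m < 5" for m
    using that by (auto simp: u_def simplices_def omit_def numeral_eq_Suc less_Suc_eq)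
  have perm: "X p q \<in> permitted b u" for p q
    unfolding X_def edge_coloring_def
    by (rule permitted_restriction)
      (auto elim!: pentachoron_cases intro: edge_functional_variation_coloring)
  have "cocycle u (X p q) (X r s) =
      cocycle_form b u (\<lambda>e. of_bool (e = (p, q))) (\<lambda>e. of_bool (e = (r, s)))" for p q r s
    by (rule cocycle_eq_form[OF u perm perm]) (auto simp: X_def edge_coloring_def restriction_def)
  then have "L (\<lambda>e f. cocycle u (X (fst e) (snd e)) (X (fst f) (snd f))) = 1"
    by (simp add: L_def cocycle_form_def u_def lessThan_5 omit_def cup_def correction_def
        omega_indicator triangle_boundary_def)
  moreover have "L (\<lambda>e f. coboundary d u (X (fst e) (snd e)) (X (fst f) (snd f))) = 0"
  proof -
    define T where "T m = L (\<lambda>e f. d (omit m u) (Y (omit m u) (fst e) (snd e)) (Y (omit m u) (fst f) (snd f)))"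
      for m
    have bil: "symmetric_bilinear_on (colorings t) (d t)" if "t \<in> simplices 3" for t
      using d that permitted_tetrahedron by (simp add: symmetric_bilinear_cochain_def)
    have Y: "Y t p q \<in> colorings t" for t p q
      by (simp add: Y_def colorings_def restriction_def)
    have restr: "restriction (omit m u) (X p q) = Y (omit m u) p q" if "m < 5" for m p q
      using faces[OF that] by (fastforce simp: X_def Y_def restriction_def tetrahedra_def fun_eq_iff)
    have "L (\<lambda>e f. coboundary d u (X (fst e) (snd e)) (X (fst f) (snd f))) =
        (\<Sum>m<5. (-1) ^ m * T m)"
      by (simp add: L_def T_def coboundary_def length_u restr lessThan_5 algebra_simps)
    moreover have "T m = 0" if "m < 5" for m
    proof (cases "m = 0")
      case False
      \<comment> \<open>The face omits the vertex \<open>m + 1\<close>, which lies on one edge of each pair.\<close>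
      have vanish: "d (omit m u) (Y (omit m u) p q) (Y (omit m u) r s) = 0"
        if "Suc m \<in> {p, q, r, s}" for p q r s
      proof -
        note t = faces[OF \<open>m < 5\<close>]
        have "Suc m \<notin> set (omit m u)"
          using \<open>m < 5\<close> by (auto simp: u_def omit_def numeral_eq_Suc less_Suc_eq)
        then have "Y (omit m u) p q = 0 \<or> Y (omit m u) r s = 0"
          using that edge_coloring_outside[OF t(1)] unfolding Y_def by blast
        moreover have "d (omit m u) 0 y = 0" if "y \<in> colorings (omit m u)" for y
        proof -
          have "0 \<in> colorings (omit m u)" "scale 0 0 = (0 :: 'a coloring)"
            by (auto simp: colorings_def scale_def fun_eq_iff zero_prod_def)
          then show ?thesis
            using bil[OF t(1)] that unfolding symmetric_bilinear_on_def by (metis mult_zero_left)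
        qed
        moreover have "d (omit m u) y 0 = d (omit m u) 0 y" if "y \<in> colorings (omit m u)" for y
        proof -
          have "0 \<in> colorings (omit m u)" by (auto simp: colorings_def)
          then show ?thesis
            using bil[OF t(1)] that unfolding symmetric_bilinear_on_def by blast
        qed
        ultimately show ?thesis using Y by metis
      qed
      have "Suc m \<in> {2, 3, 4, 5}" using False that by auto
      then have "Suc m \<in> {2, 3, 4, 5}" "Suc m \<in> {2, 4, 3, 5}" "Suc m \<in> {2, 5, 3, 4}" by blast+
      from this[THEN vanish] show ?thesis by (simp add: T_def L_def)
    next
      case True
      define t where "t = [2, 3, 4, 5 :: nat]"
      have t: "t \<in> simplices 3" by (simp add: t_def simplices_def)
      define A B C where "A = Y t 2 3" and "B = Y t 2 4" and "C = Y t 3 4"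
      have eqI: "z = z'" if "z \<in> colorings t" "z' \<in> colorings t" "z t = z' t" for z z' :: "'a coloring"
      proof
        show "z t' = z' t'" for t'
          using that tetrahedra_tetrahedron[OF t] by (cases "t' = t") (simp_all add: colorings_def)
      qed
      have add_in: "z + z' \<in> colorings t" if "z \<in> colorings t" "z' \<in> colorings t"
        for z z' :: "'a coloring"
        using that by (auto simp: colorings_def)
      have scale_in: "scale a z \<in> colorings t" if "z \<in> colorings t" for z :: "'a coloring" and a
        using that by (auto simp: colorings_def scale_def zero_prod_def)
      have ABC: "A \<in> colorings t" "B \<in> colorings t" "C \<in> colorings t"
        by (simp_all add: A_def B_def C_def Y)
      note defs = A_def B_def C_def Y_def restriction_def edge_coloring_def t_def
        variation_coloring.simps ratio_def omega_indicator triangle_boundary_def scale_def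
      have "t \<in> tetrahedra t" using t by (auto simp: tetrahedra_def)
      then have in_t: "[2, 3, 4, 5] \<in> tetrahedra [2, 3, 4, 5]" by (simp add: t_def)
      \<comment> \<open>On \<open>2345\<close> the edges at a vertex have, with signs, a coboundary as the sum of their indicators.\<close>
      have "Y t 4 5 = B + C"
      proof (rule eqI)
        show "Y t 4 5 t = (B + C) t"
          using in_t by (simp add: defs diff_divide_distrib add_divide_distrib)
      qed (simp_all add: Y ABC add_in scale_in)
      moreover have "Y t 3 5 = A + scale (-1) C"
      proof (rule eqI)
        show "Y t 3 5 t = (A + scale (-1) C) t"
          using in_t by (simp add: defs diff_divide_distrib add_divide_distrib)
      qed (simp_all add: Y ABC add_in scale_in)
      moreover have "Y t 2 5 = scale (-1) (A + B)"
      proof (rule eqI)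
        show "Y t 2 5 t = (scale (-1) (A + B)) t"
          using in_t by (simp add: defs diff_divide_distrib add_divide_distrib)
      qed (simp_all add: Y ABC add_in scale_in)
      moreover have "omit 0 u = t" by (simp add: omit_def u_def t_def)
      moreover have "d t A (B + C) - d t B (A + scale (-1) C) + d t (scale (-1) (A + B)) C = 0"
      proof -
        have sym: "d t y z = d t z y" and add: "d t (x + y) z = d t x z + d t y z"
          and scale: "d t (scale c y) z = c * d t y z"
          if "x \<in> colorings t" "y \<in> colorings t" "z \<in> colorings t" for x y z c
          using bil[OF t] that unfolding symmetric_bilinear_on_def by blast+
        show ?thesis
          using ABC sym[of A "B + C" A] sym[of _ "A + scale (-1) C" B] sym[of A A B] sym[of A A C] sym[of B B C]
          by (simp add: add scale add_in scale_in sym[of A B "A + scale (-1) C"] sym[of A A "B + C"])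
      qed
      ultimately show ?thesis
        unfolding True T_def L_def A_def B_def C_def by simp
    qed
    ultimately show ?thesis by simp
  qed
  moreover have "cocycle u (X p q) (X r s) = coboundary d u (X p q) (X r s)" for p q r s
    using eq u perm by (simp add: cochain_eq_def)
  ultimately show False by simp
qed

lemma nontrivial_cocycle: "nontrivial_symmetric_bilinear_4_cocycle b cocycle"
  unfolding nontrivial_symmetric_bilinear_4_cocycle_def symmetric_bilinear_cochain_def
  using symmetric_bilinear_on_cocycle cocycle_closed cocycle_not_coboundary
  by (metis symmetric_bilinear_cochain_def)

end

theorem mainTheorem4:
  shows "\<exists>P :: ('a :: field) edge_poly. genericity_condition P \<and>
    (\<forall>b :: nat \<times> nat \<Rightarrow> 'a. eval_poly b P \<noteq> 0 \<longrightarrow>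
      (\<exists>c. nontrivial_symmetric_bilinear_4_cocycle b c))"
proof (intro exI conjI allI impI)
  show "genericity_condition (generic_poly :: 'a edge_poly)"
    by (rule genericity_condition_generic_poly)
  fix b :: "nat \<times> nat \<Rightarrow> 'a"
  assume "eval_poly b generic_poly \<noteq> 0"
  then interpret generic_values b
    by unfold_locales (use generic_polyD in blast)+
  show "nontrivial_symmetric_bilinear_4_cocycle b cocycle"
    by (rule nontrivial_cocycle)
qed

end
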